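(* Let $\phi\in\mathbb{R}[x_1,\dots,x_4]$ be a unimodular Hessian potential of index $1$. Assume that $\phi$ admits a complex constant pivot. Then $\phi$ admits a real constant pivot.
   Context: A polynomial $\phi\in\mathbb{R}[x_1,\dots,x_n]$ is a unimodular Hessian potential of index $q$ if $\det(\operatorname{Hess}(\phi))$ is the constant polynomial $1$ or the constant polynomial $-1$, and the symmetric matrix $\operatorname{Hess}(\phi)_x$ has index $q$ (i.e. exactly $q$ negative eigenvalues, counted with multiplicity) at every $x\in\mathbb{R}^n$. A real constant pivot for $\phi$ is a nonzero constant vector $\xi\in\mathbb{R}^n$ such that $D_\xi^2\phi=\langle\operatorname{Hess}(\phi)\xi,\xi\rangle$ is a constant function. A complex constant pivot for $\phi$ is a nonzero constant vector $\zeta\in\mathbb{C}^n$ such that $\langle\operatorname{Hess}(\phi)\zeta,\zeta\rangle_{\mathbb{C}}=\sum_{i,j}\partial_i\partial_j\phi\,\zeta_i\zeta_j$ is constant, where $\langle-,-\rangle_{\mathbb{C}}$ is the standard complex bilinear (not Hermitian) pairing on $\mathbb{C}^n$. *)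

theory Defs
  imports "HOL-Analysis.Analysis" "HOL-Computational_Algebra.Polynomial"
begin

(* Real polynomials in n variables are rendered as polynomial functions on real^'n
   (real_polynomial_function); over the infinite field of reals the two notions agree, and a
   polynomial is constant iff the function it induces is constant. *)

definition partial_deriv :: "'n::finite \<Rightarrow> (real^'n \<Rightarrow> real) \<Rightarrow> real^'n \<Rightarrow> real" where
  "partial_deriv i f x = frechet_derivative f (at x) (axis i 1)"

definition hess :: "(real^'n::finite \<Rightarrow> real) \<Rightarrow> real^'n \<Rightarrow> real^'n^'n" where
  "hess \<phi> x = (\<chi> i j. partial_deriv i (partial_deriv j \<phi>) x)"

(* det (X I - A), a determinant over the polynomial ring. *)
definition charpoly :: "real^'n^'n \<Rightarrow> real poly" where
  "charpoly A = det (mat [:0, 1:] - map_matrix (\<lambda>a. [:a:]) A)"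

(* proots lists roots with multiplicity, so this counts negative eigenvalues with multiplicity.
   It is used only for symmetric matrices. *)
definition matrix_index :: "real^'n^'n \<Rightarrow> nat" where
  "matrix_index A = size (filter_mset (\<lambda>t. t < 0) (proots (charpoly A)))"

definition unimodular_hessian_potential :: "nat \<Rightarrow> (real^'n::finite \<Rightarrow> real) \<Rightarrow> bool" where
  "unimodular_hessian_potential q \<phi> \<longleftrightarrow>
     real_polynomial_function \<phi> \<and>
     ((\<forall>x. det (hess \<phi> x) = 1) \<or> (\<forall>x. det (hess \<phi> x) = -1)) \<and>
     (\<forall>x. matrix_index (hess \<phi> x) = q)"

definition real_constant_pivot :: "(real^'n::finite \<Rightarrow> real) \<Rightarrow> real^'n \<Rightarrow> bool" where
  "real_constant_pivot \<phi> \<xi> \<longleftrightarrow>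
     \<xi> \<noteq> 0 \<and> (\<lambda>x. (hess \<phi> x *v \<xi>) \<bullet> \<xi>) constant_on UNIV"

(* The pairing is complex bilinear: no complex conjugation. *)
definition complex_constant_pivot :: "(real^'n::finite \<Rightarrow> real) \<Rightarrow> complex^'n \<Rightarrow> bool" where
  "complex_constant_pivot \<phi> \<zeta> \<longleftrightarrow>
     \<zeta> \<noteq> 0 \<and>
     (\<lambda>x. \<Sum>i\<in>UNIV. \<Sum>j\<in>UNIV. complex_of_real (hess \<phi> x $ i $ j) * \<zeta> $ i * \<zeta> $ j) constant_on UNIV"

end

theory Submission
  imports Defs
begin

text \<open>
  Let \<open>\<zeta> = \<xi> + \<i> \<eta>\<close> be the complex pivot and write \<open>D\<^sub>v\<close> for the derivative in direction \<open>v\<close>.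
  Multiplying \<open>\<zeta>\<close> by a suitable complex number makes the constant value of the pairing real,
  so that \<open>D\<^sub>\<xi> D\<^sub>\<eta> \<phi> = 0\<close> and \<open>D\<^sub>\<xi> D\<^sub>\<xi> \<phi> = c + a\<close> with \<open>c = D\<^sub>\<eta> D\<^sub>\<eta> \<phi>\<close> and a real constant \<open>a\<close>
  (\<open>complex_pivot_split\<close>).  If \<open>\<xi>\<close> and \<open>\<eta>\<close> are linearly dependent, one of them is a real pivot.
  Otherwise \<open>c\<close> turns out to be constant, and then \<open>\<eta>\<close> is a real pivot.

  Since directional derivatives commute, \<open>D\<^sub>\<xi> c = D\<^sub>\<eta> c = 0\<close>.  Complete \<open>\<xi>, \<eta>\<close> by \<open>z, w\<close> to a basis and
  move from a point \<open>P\<close> along the plane, to \<open>P + x \<xi> + y \<eta>\<close>.  The upper left block of the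
  Hessian in this basis is \<open>diag (c + a, c)\<close> and does not change, the rows of \<open>\<xi>\<close> and \<open>\<eta>\<close> become
  \<open>x \<nabla>c + p\<close> and \<open>y \<nabla>c + q\<close> for constant vectors \<open>p, q\<close>, and the lower right block becomes
  \<open>(x\<^sup>2 + y\<^sup>2)/2 Hess c\<close> plus terms that are affine in \<open>x, y\<close> (here \<open>\<nabla>\<close> and \<open>Hess\<close> refer to \<open>z, w\<close>).
  The determinant of the Hessian is a nonzero constant \<open>\<delta>\<close>, so every nonconstant coefficient of this
  polynomial in \<open>x, y\<close> vanishes (\<open>block_det_on_plane\<close>).  Two cases remain.

  Suppose \<open>a = 0\<close>.  With \<open>{f, g} = f\<^sub>z g\<^sub>w - f\<^sub>w g\<^sub>z\<close>, the determinant is congruent modulo \<open>c\<close> to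
  the square of \<open>{p, q} + x {c, q} + y {p, c}\<close>.  Hence modulo \<open>c\<close> the bracket \<open>{p, q}\<close> has the
  invertible square \<open>\<delta>\<close> and annihilates \<open>{c, q}\<close> and \<open>{p, c}\<close>.  The identity
  \<open>{p, q} c\<^sub>z = {c, q} p\<^sub>z + {p, c} q\<^sub>z\<close> then shows that \<open>c\<close> divides \<open>\<delta> c\<^sub>z\<close>
  (\<open>block_det_const_imp_dvd\<close>), which has smaller degree along lines of direction \<open>z\<close>; so \<open>c\<^sub>z = 0\<close>.

  Suppose \<open>a \<noteq> 0\<close>, and that \<open>c\<close> is not constant on some line of direction \<open>z\<close>.  At all but finitely many
  points of this line the following argument applies; its nondegeneracy conditions fail identically
  only if \<open>1 / c\<close> or \<open>1 / (c + a)\<close> is affine, which no nonconstant polynomial allows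
  (\<open>pderiv_eq_0_if_inverse_affine\<close>).  The coefficients of \<open>x\<^sup>4\<close> and \<open>y\<^sup>4\<close> show that \<open>Hess c\<close> annihilates
  the direction in which \<open>c\<close> is stationary.  After a shear of the basis that makes \<open>w\<close> this direction,
  the remaining coefficients force the \<open>(w, w)\<close> entry of the Schur complement of the upper left block
  to vanish.  Its determinant is then minus a square, which means that \<open>-\<delta> c (c + a) c\<^sub>z\<^sup>2\<close> is the square
  of a polynomial (\<open>block_det_const_imp_square\<close>).  For nonconstant \<open>c\<close> this is impossible, because
  \<open>4 c (c + a) c\<^sub>z\<^sup>2\<close> is the square of \<open>(2 c + a) c\<^sub>z\<close> up to the term \<open>a\<^sup>2 c\<^sub>z\<^sup>2\<close>, whose degree is too small for
  a difference of proportional squares (\<open>pderiv_eq_0_if_square_eq\<close>).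

  As \<open>z\<close> may be any vector outside the plane, all directional derivatives of \<open>c\<close> vanish.
\<close>

section \<open>Directional derivatives of polynomial functions\<close>

definition dir_deriv :: "real^'n::finite \<Rightarrow> (real^'n \<Rightarrow> real) \<Rightarrow> real^'n \<Rightarrow> real" where
  "dir_deriv v f x = frechet_derivative f (at x) v"

lemma real_polynomial_function_has_derivative:
  fixes f :: "real^'n::finite \<Rightarrow> real"
  assumes "real_polynomial_function f"
  shows "(f has_derivative (\<lambda>v. dir_deriv v f x)) (at x)"
proof -
  have "(f has_derivative frechet_derivative f (at x)) (at x)"
    using differentiable_at_real_polynomial_function[OF assms] frechet_derivative_works by blast
  then show ?thesis
    by (simp add: dir_deriv_def eta_contract_eq)
qed

lemma dir_derivI:
  assumes "(f has_derivative f') (at x)"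
  shows "dir_deriv v f x = f' v"
  using frechet_derivative_at[OF assms] by (simp add: dir_deriv_def)

lemma dir_deriv_const [simp]: "dir_deriv v (\<lambda>x. k) = (\<lambda>x. 0)"
  by (rule ext) (simp add: dir_deriv_def)

lemma dir_deriv_linear:
  assumes "bounded_linear f"
  shows "dir_deriv v f = (\<lambda>x. f v)"
  by (rule ext) (rule dir_derivI[OF bounded_linear_imp_has_derivative[OF assms]])

lemma dir_deriv_add:
  assumes "real_polynomial_function f" "real_polynomial_function g"
  shows "dir_deriv v (\<lambda>x. f x + g x) = (\<lambda>x. dir_deriv v f x + dir_deriv v g x)"
  by (rule ext, rule dir_derivI)
     (intro has_derivative_add real_polynomial_function_has_derivative assms)

lemma dir_deriv_mult:
  assumes "real_polynomial_function f" "real_polynomial_function g"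
  shows "dir_deriv v (\<lambda>x. f x * g x) = (\<lambda>x. f x * dir_deriv v g x + dir_deriv v f x * g x)"
  by (rule ext, rule dir_derivI)
     (intro has_derivative_mult real_polynomial_function_has_derivative assms)

lemma real_polynomial_function_dir_deriv:
  assumes "real_polynomial_function f"
  shows "real_polynomial_function (dir_deriv v f)"
  using assms
  by induction (auto simp: dir_deriv_linear dir_deriv_add dir_deriv_mult)

lemma dir_deriv_commute:
  assumes "real_polynomial_function f"
  shows "dir_deriv u (dir_deriv v f) = dir_deriv v (dir_deriv u f)"
  using assms
proof induction
  case (mult f g)
  have *: "real_polynomial_function (\<lambda>x. f x * dir_deriv w g x)"
    "real_polynomial_function (\<lambda>x. dir_deriv w f x * g x)" for w
    using mult by (auto intro: real_polynomial_function_dir_deriv)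
  show ?case
    using mult * by (simp add: dir_deriv_mult dir_deriv_add
        real_polynomial_function_dir_deriv algebra_simps)
qed (simp_all add: dir_deriv_linear dir_deriv_add real_polynomial_function_dir_deriv)

lemma dir_deriv_add_direction:
  assumes "real_polynomial_function f"
  shows "dir_deriv (u + v) f = (\<lambda>x. dir_deriv u f x + dir_deriv v f x)"
proof
  fix x
  show "dir_deriv (u + v) f x = dir_deriv u f x + dir_deriv v f x"
    using linear_add[OF has_derivative_linear[OF real_polynomial_function_has_derivative[OF assms]]]
    by blast
qed

lemma dir_deriv_scale_direction:
  assumes "real_polynomial_function f"
  shows "dir_deriv (k *\<^sub>R v) f = (\<lambda>x. k * dir_deriv v f x)"
proof
  fix x
  show "dir_deriv (k *\<^sub>R v) f x = k * dir_deriv v f x"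
    using linear_cmul[OF has_derivative_linear[OF real_polynomial_function_has_derivative[OF assms]]]
    by (simp add: linear_cmul)
qed

lemma dir_deriv_zero_direction:
  assumes "real_polynomial_function f"
  shows "dir_deriv 0 f = (\<lambda>x. 0)"
  using dir_deriv_scale_direction[OF assms, of 0 0] by simp

lemma dir_deriv_line:
  assumes "real_polynomial_function f"
  shows "((\<lambda>s. f (P + s *\<^sub>R v)) has_real_derivative dir_deriv v f (P + s *\<^sub>R v)) (at s)"
proof -
  have "((\<lambda>s. f (P + s *\<^sub>R v)) has_derivative (\<lambda>h. dir_deriv (h *\<^sub>R v) f (P + s *\<^sub>R v))) (at s)"
    by (rule has_derivative_compose[of "\<lambda>s. P + s *\<^sub>R v" "\<lambda>h. h *\<^sub>R v" s UNIV f,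
          OF _ real_polynomial_function_has_derivative[OF assms]])
       (auto intro!: derivative_eq_intros)
  then show ?thesis
    by (simp add: dir_deriv_scale_direction[OF assms] has_field_derivative_def mult.commute[of _ "dir_deriv v f _"])
qed

text \<open>
  Questions about divisibility and degree are settled on lines, where polynomial functions are
  genuine univariate polynomials.
\<close>
lemma polynomial_on_line:
  assumes "real_polynomial_function f"
  obtains p where "\<And>s. f (P + s *\<^sub>R v) = poly p s"
    and "\<And>s. dir_deriv v f (P + s *\<^sub>R v) = poly (pderiv p) s"
proof -
  have "\<exists>p. \<forall>s. f (P + s *\<^sub>R v) = poly p s"
    using assms
  proof induction
    case (linear f)
    then have "f (P + s *\<^sub>R v) = poly [:f P, f v:] s" for s
      by (simp add: bounded_linear.linear linear_add linear_cmul)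
    then show ?case by blast
  next
    case (const k)
    then show ?case by (intro exI[of _ "[:k:]"]) simp
  next
    case (add f g)
    then show ?case by (metis poly_add)
  next
    case (mult f g)
    then show ?case by (metis poly_mult)
  qed
  then obtain p where p: "\<And>s. f (P + s *\<^sub>R v) = poly p s" by blast
  have line: "(\<lambda>s. f (P + s *\<^sub>R v)) = poly p"
    using p by (rule ext)
  have "dir_deriv v f (P + s *\<^sub>R v) = poly (pderiv p) s" for s
    using dir_deriv_line[OF assms, of P v s] poly_DERIV[of p s] unfolding line by (rule DERIV_unique)
  with p show ?thesis using that by blast
qed

lemma real_polynomial_function_const_if_dir_derivs_0:
  assumes f: "real_polynomial_function f" and "\<And>v. dir_deriv v f = (\<lambda>x. 0)"
  shows "f x = f y"
proof -
  have "f (x + 1 *\<^sub>R (y - x)) = f (x + 0 *\<^sub>R (y - x))"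
    by (rule DERIV_isconst_all[of "\<lambda>s. f (x + s *\<^sub>R (y - x))"])
       (use dir_deriv_line[OF f, of x "y - x"] assms(2) in auto)
  then show ?thesis by simp
qed

lemma quadratic_along_line:
  assumes f: "real_polynomial_function f"
    and const: "dir_deriv v (dir_deriv v (dir_deriv v f)) = (\<lambda>x. 0)"
  shows "f (P + s *\<^sub>R v) = f P + s * dir_deriv v f P + s\<^sup>2 / 2 * dir_deriv v (dir_deriv v f) P"
proof -
  let ?D = "dir_deriv v"
  have f1: "real_polynomial_function (?D f)" and f2: "real_polynomial_function (?D (?D f))"
    using f by (auto intro: real_polynomial_function_dir_deriv)
  have 2: "?D (?D f) (P + s *\<^sub>R v) = ?D (?D f) P" for s
  proof -
    have "?D (?D f) (P + s *\<^sub>R v) = ?D (?D f) (P + 0 *\<^sub>R v)"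
      by (rule DERIV_isconst_all[of "\<lambda>s. ?D (?D f) (P + s *\<^sub>R v)"])
         (use dir_deriv_line[OF f2, of P v] const in auto)
    then show ?thesis by simp
  qed
  have 1: "?D f (P + s *\<^sub>R v) = ?D f P + s * ?D (?D f) P" for s
  proof -
    have "?D f (P + s *\<^sub>R v) - s * ?D (?D f) P = ?D f (P + 0 *\<^sub>R v) - 0 * ?D (?D f) P"
      by (rule DERIV_isconst_all[of "\<lambda>s. ?D f (P + s *\<^sub>R v) - s * ?D (?D f) P"])
         (auto intro!: derivative_eq_intros dir_deriv_line[OF f1] simp: 2)
    then show ?thesis by simp
  qed
  have "f (P + s *\<^sub>R v) - (s * ?D f P + s\<^sup>2 / 2 * ?D (?D f) P)
      = f (P + 0 *\<^sub>R v) - (0 * ?D f P + 0\<^sup>2 / 2 * ?D (?D f) P)"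
    by (rule DERIV_isconst_all[of "\<lambda>s. f (P + s *\<^sub>R v) - (s * ?D f P + s\<^sup>2 / 2 * ?D (?D f) P)"])
       (auto intro!: derivative_eq_intros dir_deriv_line[OF f] simp: 1)
  then show ?thesis by simp
qed

lemma dir_deriv_commute_past:
  assumes "real_polynomial_function f"
  shows "dir_deriv w (dir_deriv u (dir_deriv v f)) = dir_deriv u (dir_deriv v (dir_deriv w f))"
  using dir_deriv_commute[of "dir_deriv v f" w u] dir_deriv_commute[of f w v] assms
  by (simp add: real_polynomial_function_dir_deriv)

text \<open>
  The two equal pure second derivatives and the vanishing mixed one make the quadratic part a
  multiple of \<open>x\<^sup>2 + y\<^sup>2\<close>; this is the only type of growth that occurs along the plane of the pivot.
\<close>
lemma quadratic_on_plane:
  assumes f: "real_polynomial_function f"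
    and 11: "dir_deriv u (dir_deriv u f) = h" and 22: "dir_deriv v (dir_deriv v f) = h"
    and 12: "dir_deriv u (dir_deriv v f) = (\<lambda>x. 0)"
    and h: "dir_deriv u h = (\<lambda>x. 0)" "dir_deriv v h = (\<lambda>x. 0)"
  shows "f (P + x *\<^sub>R u + y *\<^sub>R v)
    = (x\<^sup>2 + y\<^sup>2) * (h P / 2) + x * dir_deriv u f P + y * dir_deriv v f P + f P"
proof -
  have pf: "real_polynomial_function h" "real_polynomial_function (dir_deriv v f)"
    using 11 f by (auto intro: real_polynomial_function_dir_deriv)
  have "f (P + x *\<^sub>R u + y *\<^sub>R v) = f (P + x *\<^sub>R u) + y * dir_deriv v f (P + x *\<^sub>R u) + y\<^sup>2 / 2 * h (P + x *\<^sub>R u)"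
    using quadratic_along_line[OF f, of v "P + x *\<^sub>R u" y] by (simp add: 22 h)
  moreover have "f (P + x *\<^sub>R u) = f P + x * dir_deriv u f P + x\<^sup>2 / 2 * h P"
    using quadratic_along_line[OF f, of u P x] by (simp add: 11 h)
  moreover have "dir_deriv v f (P + x *\<^sub>R u) = dir_deriv v f P"
    using quadratic_along_line[OF pf(2), of u P x] by (simp add: 12)
  moreover have "h (P + x *\<^sub>R u) = h P"
    using quadratic_along_line[OF pf(1), of u P x] by (simp add: h)
  ultimately show ?thesis
    by (simp add: field_simps)
qed

section \<open>The Hessian as a bilinear form\<close>

lemma dir_deriv_coordinates:
  assumes "real_polynomial_function f"
  shows "dir_deriv v f x = (\<Sum>i\<in>UNIV. v $ i * dir_deriv (axis i 1) f x)"
proof -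
  have lin: "linear (\<lambda>v. dir_deriv v f x)"
    by (rule has_derivative_linear[OF real_polynomial_function_has_derivative[OF assms]])
  have "v = (\<Sum>i\<in>UNIV. v $ i *\<^sub>R axis i 1)"
    using basis_expansion[of v] by (simp add: scalar_mult_eq_scaleR)
  then have "dir_deriv v f x = dir_deriv (\<Sum>i\<in>UNIV. v $ i *\<^sub>R axis i 1) f x"
    by simp
  also have "\<dots> = (\<Sum>i\<in>UNIV. v $ i * dir_deriv (axis i 1) f x)"
    by (simp add: linear_sum[OF lin] linear_cmul[OF lin])
  finally show ?thesis .
qed

lemma hess_nth: "hess \<phi> x $ i $ j = dir_deriv (axis i 1) (dir_deriv (axis j 1) \<phi>) x"
proof -
  have "partial_deriv j \<phi> = dir_deriv (axis j 1) \<phi>"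
    by (rule ext) (simp add: partial_deriv_def dir_deriv_def)
  then show ?thesis
    by (simp add: hess_def partial_deriv_def dir_deriv_def)
qed

lemma second_dir_deriv_eq_hess:
  assumes "real_polynomial_function \<phi>"
  shows "dir_deriv u (dir_deriv v \<phi>) x = (\<Sum>i\<in>UNIV. \<Sum>j\<in>UNIV. hess \<phi> x $ i $ j * u $ i * v $ j)"
proof -
  note coordinates = dir_deriv_coordinates[OF real_polynomial_function_dir_deriv[OF assms]]
  have "dir_deriv (axis i 1) (dir_deriv v \<phi>) x = (\<Sum>j\<in>UNIV. v $ j * hess \<phi> x $ i $ j)" for i
  proof -
    have "dir_deriv (axis i 1) (dir_deriv v \<phi>) x = dir_deriv v (dir_deriv (axis i 1) \<phi>) x"
      by (simp only: dir_deriv_commute[OF assms, of v "axis i 1"])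
    also have "\<dots> = (\<Sum>j\<in>UNIV. v $ j * dir_deriv (axis j 1) (dir_deriv (axis i 1) \<phi>) x)"
      by (rule coordinates)
    finally show ?thesis
      by (simp only: hess_nth dir_deriv_commute[OF assms, of "axis i 1"])
  qed
  then show ?thesis
    using coordinates[of u v x]
    by (simp add: sum_distrib_left mult_ac)
qed

lemma hess_quadratic_form:
  assumes "real_polynomial_function \<phi>"
  shows "(hess \<phi> x *v \<xi>) \<bullet> \<xi> = dir_deriv \<xi> (dir_deriv \<xi> \<phi>) x"
  by (simp add: second_dir_deriv_eq_hess[OF assms] inner_vec_def matrix_vector_mult_def sum_distrib_left mult_ac)

lemma hess_congruence:
  fixes R :: "real^'n::finite^'n"
  assumes "real_polynomial_function \<phi>"
  shows "(R ** hess \<phi> x ** transpose R) $ i $ j = dir_deriv (R $ i) (dir_deriv (R $ j) \<phi>) x"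
proof -
  have "(R ** hess \<phi> x ** transpose R) $ i $ j
      = (\<Sum>l\<in>UNIV. \<Sum>k\<in>UNIV. R $ i $ k * hess \<phi> x $ k $ l * R $ j $ l)"
    by (simp add: matrix_matrix_mult_def transpose_def sum_distrib_right)
  also have "\<dots> = (\<Sum>k\<in>UNIV. \<Sum>l\<in>UNIV. R $ i $ k * hess \<phi> x $ k $ l * R $ j $ l)"
    by (rule sum.swap)
  finally show ?thesis
    by (simp add: second_dir_deriv_eq_hess[OF assms] mult_ac)
qed

text \<open>
  Replacing \<open>\<zeta>\<close> by \<open>u \<zeta>\<close> multiplies the constant value \<open>k\<close> of the pairing by \<open>u\<^sup>2\<close>.  If
  \<open>k \<noteq> 0\<close>, a square root \<open>u\<close> of the conjugate of \<open>k\<close> turns it into the real number \<open>\<bar>k\<bar>\<^sup>2\<close>.  Its vanishing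
  imaginary part is twice the mixed derivative along the real and imaginary parts of \<open>u \<zeta>\<close>.
\<close>
lemma complex_pivot_split:
  fixes \<phi> :: "real^'n::finite \<Rightarrow> real"
  assumes \<phi>: "real_polynomial_function \<phi>" and "complex_constant_pivot \<phi> \<zeta>"
  obtains \<xi> \<eta> a where "\<xi> \<noteq> 0 \<or> \<eta> \<noteq> 0"
    and "dir_deriv \<xi> (dir_deriv \<eta> \<phi>) = (\<lambda>x. 0)"
    and "dir_deriv \<xi> (dir_deriv \<xi> \<phi>) = (\<lambda>x. dir_deriv \<eta> (dir_deriv \<eta> \<phi>) x + a)"
proof -
  let ?Q = "\<lambda>\<zeta> x. \<Sum>i\<in>UNIV. \<Sum>j\<in>UNIV. complex_of_real (hess \<phi> x $ i $ j) * \<zeta> $ i * \<zeta> $ j"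
  from assms(2) have "\<zeta> \<noteq> 0" and "?Q \<zeta> constant_on UNIV"
    unfolding complex_constant_pivot_def by simp_all
  then obtain k where k: "?Q \<zeta> x = k" for x
    unfolding constant_on_def by auto
  define u where "u = (if k = 0 then 1 else csqrt (cnj k))"
  have "u \<noteq> 0"
    by (simp add: u_def)
  have uk: "u\<^sup>2 * k = of_real ((cmod k)\<^sup>2)"
    by (cases "k = 0") (auto simp: u_def complex_norm_square mult.commute simp del: of_real_power)
  define \<omega> where "\<omega> = (\<chi> i. u * \<zeta> $ i)"
  have \<omega>: "?Q \<omega> x = of_real ((cmod k)\<^sup>2)" for x
  proof -
    have "?Q \<omega> x = u\<^sup>2 * ?Q \<zeta> x"
      by (simp add: \<omega>_def sum_distrib_left power2_eq_square mult_ac)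
    then show ?thesis
      unfolding k uk .
  qed
  define \<xi> where "\<xi> = (\<chi> i. Re (\<omega> $ i))"
  define \<eta> where "\<eta> = (\<chi> i. Im (\<omega> $ i))"
  have Re: "Re (?Q \<omega> x) = dir_deriv \<xi> (dir_deriv \<xi> \<phi>) x - dir_deriv \<eta> (dir_deriv \<eta> \<phi>) x" for x
    by (simp add: second_dir_deriv_eq_hess[OF \<phi>] \<xi>_def \<eta>_def algebra_simps flip: sum_subtractf)
  have Im: "Im (?Q \<omega> x) = dir_deriv \<xi> (dir_deriv \<eta> \<phi>) x + dir_deriv \<eta> (dir_deriv \<xi> \<phi>) x" for x
    by (simp add: second_dir_deriv_eq_hess[OF \<phi>] \<xi>_def \<eta>_def algebra_simps flip: sum.distrib)
  show ?thesis
  proof (rule that)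
    show "\<xi> \<noteq> 0 \<or> \<eta> \<noteq> 0"
    proof (rule ccontr)
      assume "\<not> ?thesis"
      then have "\<omega> $ i = 0" for i
        by (simp add: \<xi>_def \<eta>_def vec_eq_iff complex_eq_iff)
      then show False
        using \<open>u \<noteq> 0\<close> \<open>\<zeta> \<noteq> 0\<close> by (simp add: \<omega>_def vec_eq_iff)
    qed
    show "dir_deriv \<xi> (dir_deriv \<eta> \<phi>) = (\<lambda>x. 0)"
      using Im unfolding \<omega> dir_deriv_commute[OF \<phi>, of \<eta> \<xi>] by (intro ext) simp
    show "dir_deriv \<xi> (dir_deriv \<xi> \<phi>) = (\<lambda>x. dir_deriv \<eta> (dir_deriv \<eta> \<phi>) x + (cmod k)\<^sup>2)"
    proof
      show "dir_deriv \<xi> (dir_deriv \<xi> \<phi>) x = dir_deriv \<eta> (dir_deriv \<eta> \<phi>) x + (cmod k)\<^sup>2" for x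
        using Re[of x] unfolding \<omega> by simp
    qed
  qed
qed

section \<open>Determinants with a diagonal upper left block\<close>

lemma det_4:
  fixes A :: "'a::comm_ring_1^4^4"
  shows "det A =
      A$1$1 * (A$2$2 * (A$3$3 * A$4$4 - A$3$4 * A$4$3) + A$2$3 * (A$3$4 * A$4$2 - A$3$2 * A$4$4)
        + A$2$4 * (A$3$2 * A$4$3 - A$3$3 * A$4$2))
    - A$1$2 * (A$2$1 * (A$3$3 * A$4$4 - A$3$4 * A$4$3) + A$2$3 * (A$3$4 * A$4$1 - A$3$1 * A$4$4)
        + A$2$4 * (A$3$1 * A$4$3 - A$3$3 * A$4$1))
    + A$1$3 * (A$2$1 * (A$3$2 * A$4$4 - A$3$4 * A$4$2) + A$2$2 * (A$3$4 * A$4$1 - A$3$1 * A$4$4)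
        + A$2$4 * (A$3$1 * A$4$2 - A$3$2 * A$4$1))
    - A$1$4 * (A$2$1 * (A$3$2 * A$4$3 - A$3$3 * A$4$2) + A$2$2 * (A$3$3 * A$4$1 - A$3$1 * A$4$3)
        + A$2$3 * (A$3$1 * A$4$2 - A$3$2 * A$4$1))"
proof -
  have f1: "finite {2::4, 3, 4}" "1 \<notin> {2::4, 3, 4}"
    and f2: "finite {3::4, 4}" "2 \<notin> {3::4, 4}"
    and f3: "finite {4::4}" "3 \<notin> {4::4}"
    by auto
  show ?thesis
    unfolding det_def UNIV_4
    unfolding sum_over_permutations_insert[OF f1]
    unfolding sum_over_permutations_insert[OF f2]
    unfolding sum_over_permutations_insert[OF f3]
    unfolding permutes_sing
    by (simp add: sign_swap_id permutation_swap_id permutation_compose sign_compose sign_id swap_id_eq cong: if_cong)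
       (simp add: algebra_simps)
qed

text \<open>
  The determinant of the symmetric matrix with upper left block \<open>diag (\<alpha>, \<gamma>)\<close>, upper right rows \<open>u\<close> and \<open>v\<close>
  and lower right block \<open>m\<close>, grouped by powers of \<open>\<alpha>\<close> and \<open>\<gamma>\<close> as in the expansion of
  \<open>\<alpha> \<gamma> det (m - u\<^sup>T u / \<alpha> - v\<^sup>T v / \<gamma>)\<close>.
\<close>
definition block_det :: "real \<Rightarrow> real \<Rightarrow> real \<Rightarrow> real \<Rightarrow> real \<Rightarrow> real \<Rightarrow> real \<Rightarrow> real \<Rightarrow> real \<Rightarrow> real" where
  "block_det \<alpha> \<gamma> uz uw vz vw mzz mzw mww =
     \<alpha> * \<gamma> * (mzz * mww - mzw\<^sup>2)
     - \<gamma> * (mzz * uw\<^sup>2 - 2 * mzw * uz * uw + mww * uz\<^sup>2)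
     - \<alpha> * (mzz * vw\<^sup>2 - 2 * mzw * vz * vw + mww * vz\<^sup>2)
     + (uz * vw - uw * vz)\<^sup>2"

lemma det_eq_block_det:
  fixes A :: "real^4^4"
  assumes "A$1$1 = \<alpha>" "A$1$2 = 0" "A$1$3 = uz" "A$1$4 = uw"
    "A$2$1 = 0" "A$2$2 = \<gamma>" "A$2$3 = vz" "A$2$4 = vw"
    "A$3$1 = uz" "A$3$2 = vz" "A$3$3 = mzz" "A$3$4 = mzw"
    "A$4$1 = uw" "A$4$2 = vw" "A$4$3 = mzw" "A$4$4 = mww"
  shows "det A = block_det \<alpha> \<gamma> uz uw vz vw mzz mzw mww"
  unfolding det_4 assms block_det_def by (simp add: power2_eq_square algebra_simps)

lemmas zero_arith = mult_zero_left mult_zero_right add_0_left add_0_right zero_power2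

text \<open>Adding \<open>t\<close> times the third basis vector to the fourth is a unimodular congruence.\<close>
lemma block_det_shear:
  "block_det \<alpha> \<gamma> uz (t * uz + uw) vz (t * vz + vw) mzz (t * mzz + mzw) (t\<^sup>2 * mzz + 2 * t * mzw + mww)
   = block_det \<alpha> \<gamma> uz uw vz vw mzz mzw mww"
  unfolding block_det_def by algebra

text \<open>
  If both diagonal entries are \<open>\<gamma>\<close>, the determinant is congruent to a square modulo \<open>\<gamma>\<close>.  The quotient is
  given a name because divisibility is later used in a ring of polynomial functions, where the
  quotient must be seen to be polynomial as well.
\<close>
definition block_quot :: "real \<Rightarrow> real \<Rightarrow> real \<Rightarrow> real \<Rightarrow> real \<Rightarrow> real \<Rightarrow> real \<Rightarrow> real \<Rightarrow> real" where
  "block_quot \<gamma> uz uw vz vw mzz mzw mww =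
     \<gamma> * (mzz * mww - mzw\<^sup>2)
     - (mzz * uw\<^sup>2 - 2 * mzw * uz * uw + mww * uz\<^sup>2)
     - (mzz * vw\<^sup>2 - 2 * mzw * vz * vw + mww * vz\<^sup>2)"

lemma block_det_eq_block_quot:
  "block_det \<gamma> \<gamma> uz uw vz vw mzz mzw mww
   = \<gamma> * block_quot \<gamma> uz uw vz vw mzz mzw mww + (uz * vw - uw * vz)\<^sup>2"
  by (simp add: block_det_def block_quot_def algebra_simps)

section \<open>Consequences of a constant determinant along the plane\<close>

text \<open>
  In this section \<open>x, y\<close> are the coordinates in the plane of the pivot, and all other letters stand for
  values at a base point: \<open>cz, cw\<close> is the gradient of \<open>c\<close> and \<open>hzz, hzw, hww\<close> is half its Hessian;
  \<open>pz, pw\<close> and \<open>qz, qw\<close> are the entries of the Hessian of \<open>\<phi>\<close> in the rows of \<open>\<xi>\<close> and \<open>\<eta>\<close>, and letters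
  such as \<open>pzw\<close> are their derivatives; \<open>rzz, rzw, rww\<close> is its lower right block.
\<close>

text \<open>
  The bracket identity \<open>{p, q} c\<^sub>z = {c, q} p\<^sub>z + {p, c} q\<^sub>z\<close>, multiplied by \<open>{p, q}\<close>, expresses
  \<open>\<delta> c\<^sub>z\<close> as a multiple of \<open>c\<close>.  The factor is displayed because its dependence on the base point has to be
  polynomial.
\<close>
lemma block_det_const_imp_dvd:
  fixes Z :: "real \<Rightarrow> real \<Rightarrow> real"
  assumes Z: "Z = (\<lambda>x y. block_quot c (x * cz + pz) (x * cw + pw) (y * cz + qz) (y * cw + qw)
      ((x\<^sup>2 + y\<^sup>2) * hzz + x * pzz + y * qzz + rzz)
      ((x\<^sup>2 + y\<^sup>2) * hzw + x * pzw + y * qzw + rzw)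
      ((x\<^sup>2 + y\<^sup>2) * hww + x * pww + y * qww + rww))"
    and det: "\<And>x y. block_det c c (x * cz + pz) (x * cw + pw) (y * cz + qz) (y * cw + qw)
      ((x\<^sup>2 + y\<^sup>2) * hzz + x * pzz + y * qzz + rzz)
      ((x\<^sup>2 + y\<^sup>2) * hzw + x * pzw + y * qzw + rzw)
      ((x\<^sup>2 + y\<^sup>2) * hww + x * pww + y * qww + rww) = \<delta>"
  shows "\<delta> * cz = c * (Z 0 0 * cz - ((Z 1 0 - Z (-1) 0) * pz + (Z 0 1 - Z 0 (-1)) * qz) / 4)"
proof -
  have E: "c * Z x y + ((x * cz + pz) * (y * cw + qw) - (x * cw + pw) * (y * cz + qz))\<^sup>2 = \<delta>" for x y
    using det[of x y] unfolding block_det_eq_block_quot Z .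
  (* the brackets {p, q}, {c, q} and {p, c} *)
  define pq cq pc where "pq = pz * qw - pw * qz" and "cq = cz * qw - cw * qz" and "pc = pz * cw - pw * cz"
  have 0: "\<delta> = c * Z 0 0 + pq\<^sup>2"
    using E[of 0 0] by (simp add: pq_def)
  (* The values at 1 and -1 isolate the odd part: the square contributes only its linear term. *)
  have "c * Z x 0 + (pq + x * cq)\<^sup>2 = \<delta>" for x
    using E[of x 0] by (simp add: pq_def cq_def algebra_simps)
  from this[of 1] this[of "-1"] have 1: "4 * (pq * cq) = - (c * (Z 1 0 - Z (-1) 0))"
    by (simp add: power2_eq_square algebra_simps)
  have "c * Z 0 y + (pq + y * pc)\<^sup>2 = \<delta>" for y
    using E[of 0 y] by (simp add: pq_def pc_def algebra_simps)
  from this[of 1] this[of "-1"] have 2: "4 * (pq * pc) = - (c * (Z 0 1 - Z 0 (-1)))"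
    by (simp add: power2_eq_square algebra_simps)
  have "pq * cz = cq * pz + pc * qz"
    by (simp add: pq_def cq_def pc_def algebra_simps)
  then have "4 * (pq\<^sup>2 * cz) = 4 * (pq * cq) * pz + 4 * (pq * pc) * qz"
    by algebra
  then have "4 * (pq\<^sup>2 * cz) = - c * ((Z 1 0 - Z (-1) 0) * pz + (Z 0 1 - Z 0 (-1)) * qz)"
    unfolding 1 2 by (simp add: algebra_simps)
  then show ?thesis
    unfolding 0 by (simp add: field_simps)
qed

text \<open>
  Here the fourth basis vector is already the direction in which \<open>c\<close> is stationary to second order.
  The Schur complement of the upper left block has the constant determinant \<open>\<delta> / (\<alpha> c)\<close>.  Its \<open>(z, z)\<close>
  entry contains \<open>x\<^sup>2\<close> and \<open>y\<^sup>2\<close> with nonzero coefficients but not \<open>x y\<close>, and its other entries are affine in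
  \<open>x, y\<close>.  The absence of cubic terms makes the \<open>(w, w)\<close> entry constant.  If it were not zero, the
  quadratic terms would make the square of the \<open>(z, w)\<close> entry contain both \<open>x\<^sup>2\<close> and \<open>y\<^sup>2\<close> but not \<open>x y\<close>,
  which is impossible.  So it is zero, and the determinant is minus the square of the \<open>(z, w)\<close> entry.
\<close>
lemma block_det_const_imp_square_adapted:
  fixes F :: "real \<Rightarrow> real \<Rightarrow> real"
  assumes F_def: "F = (\<lambda>x y. block_det \<alpha> c (x * cz + pz) pw (y * cz + qz) qw
      ((x\<^sup>2 + y\<^sup>2) * hzz + x * pzz + y * qzz + rzz)
      (x * pzw + y * qzw + rzw) (x * pww + y * qww + rww))"
    and F: "\<And>x y. F x y = \<delta>"
    and nz: "\<alpha> \<noteq> 0" "c \<noteq> 0" "\<alpha> * hzz \<noteq> cz\<^sup>2" "c * hzz \<noteq> cz\<^sup>2"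
  shows "(\<alpha> * c * rzw - c * pz * pw - \<alpha> * qz * qw)\<^sup>2 = - \<delta> * \<alpha> * c"
proof -
  (* Differences with these weights extract the coefficient of the third power of x, then of y. *)
  have "12 * c * ((\<alpha> * hzz - cz\<^sup>2) * pww) * x ^ 3 = F (2 * x) 0 - 2 * F x 0 + 2 * F (-x) 0 - F (-2 * x) 0" for x
    unfolding F_def block_det_def by algebra
  from this[of 1] have pww: "pww = 0"
    using nz F by simp
  have "12 * \<alpha> * ((c * hzz - cz\<^sup>2) * qww) * y ^ 3 = F 0 (2 * y) - 2 * F 0 y + 2 * F 0 (-y) - F 0 (-2 * y)" for y
    unfolding F_def block_det_def by algebra
  from this[of 1] have qww: "qww = 0"
    using nz F by simp
  (* \<sigma> / (\<alpha> c) is the (w, w) entry of the Schur complement; up to nonzero factors, m and n are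
     the coefficients of x and y in its (z, w) entry. *)
  define \<sigma> where "\<sigma> = \<alpha> * c * rww - c * pw\<^sup>2 - \<alpha> * qw\<^sup>2"
  define m where "m = \<alpha> * pzw - cz * pw"
  define n where "n = c * qzw - cz * qw"
  have "2 * ((\<alpha> * hzz - cz\<^sup>2) * \<sigma> - c * m\<^sup>2) * x\<^sup>2 = \<alpha> * (F x 0 + F (-x) 0 - 2 * F 0 0)" for x
    unfolding F_def block_det_def pww qww \<sigma>_def m_def zero_arith by algebra
  from this[of 1] have x2: "(\<alpha> * hzz - cz\<^sup>2) * \<sigma> = c * m\<^sup>2"
    by (simp add: F)
  have "2 * ((c * hzz - cz\<^sup>2) * \<sigma> - \<alpha> * n\<^sup>2) * y\<^sup>2 = c * (F 0 y + F 0 (-y) - 2 * F 0 0)" for y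
    unfolding F_def block_det_def pww qww \<sigma>_def n_def zero_arith by algebra
  from this[of 1] have y2: "(c * hzz - cz\<^sup>2) * \<sigma> = \<alpha> * n\<^sup>2"
    by (simp add: F)
  have "-8 * (m * n) * (x * y) = F x y - F x (-y) - F (-x) y + F (-x) (-y)" for x y
    unfolding F_def block_det_def pww qww m_def n_def zero_arith by algebra
  from this[of 1 1] have "m * n = 0"
    by (simp add: F)
  with x2 y2 nz have \<sigma>: "\<sigma> = 0"
    by auto
  have "(\<alpha> * c * rzw - c * pz * pw - \<alpha> * qz * qw)\<^sup>2
      = (\<alpha> * c * rzz - c * pz\<^sup>2 - \<alpha> * qz\<^sup>2) * \<sigma> - F 0 0 * \<alpha> * c"
    unfolding F_def block_det_def pww qww \<sigma>_def zero_arith by algebra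
  then show ?thesis
    by (simp add: F \<sigma>)
qed

text \<open>
  The general frame reduces to the previous one.  Let \<open>d\<close> be the determinant of \<open>h\<close> and \<open>K\<close> the value of \<open>h\<close> on
  the tangent of the level curve of \<open>c\<close>.  Up to nonzero factors, the coefficients of \<open>x\<^sup>4\<close> and \<open>y\<^sup>4\<close> are
  \<open>\<alpha> d - K\<close> and \<open>c d - K\<close>; as \<open>\<alpha> \<noteq> c\<close>, both \<open>d\<close> and \<open>K\<close> vanish.  The factor \<open>cz\<^sup>2\<close> clears the
  denominators of the shear, so that the expression under the square is polynomial in the base point.
\<close>
lemma block_det_const_imp_square:
  fixes F :: "real \<Rightarrow> real \<Rightarrow> real"
  assumes F_def: "F = (\<lambda>x y. block_det \<alpha> c (x * cz + pz) (x * cw + pw) (y * cz + qz) (y * cw + qw)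
      ((x\<^sup>2 + y\<^sup>2) * hzz + x * pzz + y * qzz + rzz)
      ((x\<^sup>2 + y\<^sup>2) * hzw + x * pzw + y * qzw + rzw)
      ((x\<^sup>2 + y\<^sup>2) * hww + x * pww + y * qww + rww))"
    and F: "\<And>x y. F x y = \<delta>"
    and nz: "\<alpha> \<noteq> 0" "c \<noteq> 0" "cz \<noteq> 0" "\<alpha> \<noteq> c" "\<alpha> * hzz \<noteq> cz\<^sup>2" "c * hzz \<noteq> cz\<^sup>2"
  shows "(\<alpha> * c * (cz * rzw - cw * rzz) - c * pz * (cz * pw - cw * pz)
      - \<alpha> * qz * (cz * qw - cw * qz))\<^sup>2 = - \<delta> * \<alpha> * c * cz\<^sup>2"
proof -
  (* the form h on the tangent vector (- cw, cz) *)
  define K where "K = hzz * cw\<^sup>2 - 2 * hzw * cz * cw + hww * cz\<^sup>2"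
  have "24 * c * (\<alpha> * (hzz * hww - hzw\<^sup>2) - K) * x ^ 4
      = F (2 * x) 0 - 4 * F x 0 + 6 * F 0 0 - 4 * F (-x) 0 + F (-2 * x) 0" for x
    unfolding F_def block_det_def K_def zero_arith by algebra
  from this[of 1] have x4: "\<alpha> * (hzz * hww - hzw\<^sup>2) = K"
    using nz F by simp
  have "24 * \<alpha> * (c * (hzz * hww - hzw\<^sup>2) - K) * y ^ 4
      = F 0 (2 * y) - 4 * F 0 y + 6 * F 0 0 - 4 * F 0 (-y) + F 0 (-2 * y)" for y
    unfolding F_def block_det_def K_def zero_arith by algebra
  from this[of 1] have y4: "c * (hzz * hww - hzw\<^sup>2) = K"
    using nz F by simp
  have "(\<alpha> - c) * (hzz * hww - hzw\<^sup>2) = 0"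
    using x4 y4 by (simp add: left_diff_distrib)
  then have det0: "hzz * hww - hzw\<^sup>2 = 0"
    using nz by simp
  with x4 have K0: "K = 0"
    by simp
  (* A degenerate symmetric form annihilates each of its isotropic vectors. *)
  have "(cz * hzw - cw * hzz)\<^sup>2 = hzz * K - cz\<^sup>2 * (hzz * hww - hzw\<^sup>2)"
    unfolding K_def by algebra
  then have kz: "cz * hzw = cw * hzz"
    unfolding det0 K0 by simp
  have "(cz * hww - cw * hzw)\<^sup>2 = hww * K - cw\<^sup>2 * (hzz * hww - hzw\<^sup>2)"
    unfolding K_def by algebra
  then have kw: "cz * hww = cw * hzw"
    unfolding det0 K0 by simp
  define t where "t = cw / cz"
  have tw: "cw = t * cz"
    using nz by (simp add: t_def)
  have "cz * hzw = cz * (t * hzz)"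
    unfolding kz by (subst tw) simp
  then have tzw: "hzw = t * hzz"
    using nz by simp
  have "cz * hww = cz * (t\<^sup>2 * hzz)"
    unfolding kw by (subst tw, subst tzw) (simp add: power2_eq_square)
  then have tww: "hww = t\<^sup>2 * hzz"
    using nz by simp
  have "(\<alpha> * c * (rzw - t * rzz) - c * pz * (pw - t * pz) - \<alpha> * qz * (qw - t * qz))\<^sup>2 = - \<delta> * \<alpha> * c"
  proof (rule block_det_const_imp_square_adapted[OF refl, where cz = cz and hzz = hzz and pzz = pzz
        and qzz = qzz and rzz = rzz and pzw = "pzw - t * pzz" and qzw = "qzw - t * qzz" and pww = "pww - 2 * t * pzw + t\<^sup>2 * pzz"
        and qww = "qww - 2 * t * qzw + t\<^sup>2 * qzz" and rww = "rww - 2 * t * rzw + t\<^sup>2 * rzz"])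
    fix x y
    let ?mzz = "(x\<^sup>2 + y\<^sup>2) * hzz + x * pzz + y * qzz + rzz"
    let ?mzw = "x * (pzw - t * pzz) + y * (qzw - t * qzz) + (rzw - t * rzz)"
    let ?mww = "x * (pww - 2 * t * pzw + t\<^sup>2 * pzz) + y * (qww - 2 * t * qzw + t\<^sup>2 * qzz)
            + (rww - 2 * t * rzw + t\<^sup>2 * rzz)"
    have e: "x * cw + pw = t * (x * cz + pz) + (pw - t * pz)"
      "y * cw + qw = t * (y * cz + qz) + (qw - t * qz)"
      "(x\<^sup>2 + y\<^sup>2) * hzw + x * pzw + y * qzw + rzw = t * ?mzz + ?mzw"
      "(x\<^sup>2 + y\<^sup>2) * hww + x * pww + y * qww + rww = t\<^sup>2 * ?mzz + 2 * t * ?mzw + ?mww"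
      unfolding tw tzw tww by algebra+
    have "\<delta> = block_det \<alpha> c (x * cz + pz) (x * cw + pw) (y * cz + qz) (y * cw + qw) ?mzz
        ((x\<^sup>2 + y\<^sup>2) * hzw + x * pzw + y * qzw + rzw)
        ((x\<^sup>2 + y\<^sup>2) * hww + x * pww + y * qww + rww)"
      using F[of x y] unfolding F_def by (rule sym)
    also have "\<dots> = block_det \<alpha> c (x * cz + pz) (pw - t * pz) (y * cz + qz) (qw - t * qz) ?mzz ?mzw ?mww"
      unfolding e by (rule block_det_shear)
    finally show "block_det \<alpha> c (x * cz + pz) (pw - t * pz) (y * cz + qz) (qw - t * qz) ?mzz ?mzw ?mww = \<delta>"
      by (rule sym)
  qed (use nz in auto)
  moreover have "\<alpha> * c * (cz * rzw - cw * rzz) - c * pz * (cz * pw - cw * pz) - \<alpha> * qz * (cz * qw - cw * qz)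
     = cz * (\<alpha> * c * (rzw - t * rzz) - c * pz * (pw - t * pz) - \<alpha> * qz * (qw - t * qz))"
    unfolding tw by algebra
  ultimately show ?thesis
    by (simp add: power_mult_distrib)
qed

section \<open>Two equations that force univariate polynomials to be constant\<close>

text \<open>
  The equation says that \<open>1 / G\<close> is affine.  For \<open>G\<close> of degree \<open>n \<ge> 1\<close>, comparing the coefficients of degree \<open>2 n - 2\<close> would give \<open>n (n - 1) = 2 n\<^sup>2\<close>.
\<close>
lemma pderiv_eq_0_if_inverse_affine:
  fixes G :: "real poly"
  assumes "G * pderiv (pderiv G) = smult 2 ((pderiv G)\<^sup>2)"
  shows "pderiv G = 0"
proof (rule ccontr)
  assume nz: "pderiv G \<noteq> 0"
  then obtain d where d: "degree G = Suc d"
    by (metis pderiv_eq_0_iff not0_implies_Suc)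
  have deg: "degree (pderiv G) = d" "degree (pderiv (pderiv G)) = d - 1"
    by (simp_all add: degree_pderiv d)
  let ?l = "lead_coeff G"
  have "G \<noteq> 0" using d by auto
  then have l: "?l \<noteq> 0" by simp
  have 1: "lead_coeff (pderiv G) = real (Suc d) * ?l"
    unfolding deg coeff_pderiv[of G] d ..
  have "coeff (smult 2 ((pderiv G)\<^sup>2)) (2 * d) = 2 * (lead_coeff (pderiv G) * lead_coeff (pderiv G))"
    using coeff_mult_degree_sum[of "pderiv G" "pderiv G"]
    by (simp only: deg power2_eq_square coeff_smult flip: mult_2)
  then have R: "coeff (smult 2 ((pderiv G)\<^sup>2)) (2 * d) = 2 * (real (Suc d))\<^sup>2 * ?l\<^sup>2"
    unfolding 1 by (simp only: power2_eq_square mult_ac)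
  have L: "coeff (G * pderiv (pderiv G)) (2 * d) = real (Suc d) * real d * ?l\<^sup>2"
  proof (cases d)
    case 0
    then have "pderiv (pderiv G) = 0"
      using deg by (simp add: pderiv_eq_0_iff)
    then show ?thesis using 0 by simp
  next
    case (Suc e)
    then have "2 * d = degree G + degree (pderiv (pderiv G))"
      using d deg by simp
    then have "coeff (G * pderiv (pderiv G)) (2 * d) = ?l * lead_coeff (pderiv (pderiv G))"
      by (simp only: coeff_mult_degree_sum)
    also have "lead_coeff (pderiv (pderiv G)) = real d * lead_coeff (pderiv G)"
      unfolding deg coeff_pderiv[of "pderiv G"] using Suc by simp
    finally show ?thesis
      unfolding 1 by (simp only: power2_eq_square mult_ac)
  qed
  have "real (Suc d) * real d = 2 * (real (Suc d))\<^sup>2"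
    using L R l unfolding assms by simp
  then have "real (Suc d) * (real d + 2) = 0"
    by (simp add: power2_eq_square algebra_simps)
  then show False by simp
qed

text \<open>
  With \<open>V = 2 C + a\<close> the equation becomes \<open>4 T\<^sup>2 = \<kappa> (V\<^sup>2 - a\<^sup>2) C'\<^sup>2\<close>.  The leading coefficients exhibit \<open>\<kappa>\<close>
  as a square \<open>k\<^sup>2\<close>, so the difference of squares \<open>(k V C' - 2 T) (k V C' + 2 T)\<close> equals \<open>\<kappa> a\<^sup>2 C'\<^sup>2\<close>, whose degree is
  too small.
\<close>
lemma pderiv_eq_0_if_square_eq:
  fixes C T :: "real poly"
  assumes T: "T\<^sup>2 = smult \<kappa> (C * (C + [:a:]) * (pderiv C)\<^sup>2)" and "\<kappa> \<noteq> 0" "a \<noteq> 0"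
  shows "pderiv C = 0"
proof (rule ccontr)
  assume nz: "pderiv C \<noteq> 0"
  define V where "V = smult 2 C + [:a:]"
  define X where "X = V * pderiv C"
  have degC: "degree C \<noteq> 0"
    using nz by (simp add: pderiv_eq_0_iff)
  then have degV: "degree V = degree C"
    unfolding V_def by (subst degree_add_eq_left) auto
  then have "V \<noteq> 0"
    using degC by auto
  then have "X \<noteq> 0" and degX: "degree X = degree C + degree (pderiv C)"
    using nz by (auto simp: X_def degV degree_mult_eq)
  have deg': "degree (pderiv C) < degree C"
    using degC by (simp add: degree_pderiv)
  have T4: "smult 4 (T\<^sup>2) = smult \<kappa> (X\<^sup>2) - smult (\<kappa> * a\<^sup>2) ((pderiv C)\<^sup>2)"
    unfolding T
    by (rule poly_eq_poly_eq_iff[THEN iffD1], rule ext)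
       (simp add: X_def V_def power2_eq_square algebra_simps)
  have "degree (smult (\<kappa> * a\<^sup>2) ((pderiv C)\<^sup>2)) < degree (smult \<kappa> (X\<^sup>2))"
    using \<open>X \<noteq> 0\<close> nz deg' assms(2,3) by (simp add: degree_power_eq degX)
  then have "lead_coeff (smult 4 (T\<^sup>2)) = lead_coeff (smult \<kappa> (X\<^sup>2))"
    unfolding T4 using lead_coeff_add_le[of "- smult (\<kappa> * a\<^sup>2) ((pderiv C)\<^sup>2)" "smult \<kappa> (X\<^sup>2)"]
    by (metis add.commute degree_minus lead_coeff_add_le uminus_add_conv_diff)
  then have "4 * (lead_coeff T)\<^sup>2 = \<kappa> * (lead_coeff X)\<^sup>2"
    by (simp add: lead_coeff_smult lead_coeff_power)
  then have \<kappa>: "\<kappa> = (2 * lead_coeff T / lead_coeff X)\<^sup>2"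
    using \<open>X \<noteq> 0\<close> by (simp add: field_simps power_mult_distrib)
  (* \<kappa> is a square, so the equation T4 factors over the reals. *)
  define k where "k = 2 * lead_coeff T / lead_coeff X"
  have "k \<noteq> 0"
    using \<kappa> assms(2) by (auto simp: k_def)
  define Y where "Y = smult k X - smult 2 T"
  define Z where "Z = smult k X + smult 2 T"
  have YZ: "Y * Z = smult (\<kappa> * a\<^sup>2) ((pderiv C)\<^sup>2)"
  proof -
    have "Y * Z = smult (k\<^sup>2) (X\<^sup>2) - smult 4 (T\<^sup>2)"
      unfolding Y_def Z_def by (simp add: power2_eq_square algebra_simps)
    also have "\<dots> = smult (\<kappa> * a\<^sup>2) ((pderiv C)\<^sup>2)"
      unfolding T4 \<kappa> k_def by simp
    finally show ?thesis .
  qed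
  then have "Y * Z \<noteq> 0"
    using nz assms by simp
  then have "degree Y + degree Z = degree (Y * Z)"
    by (simp add: degree_mult_eq)
  also have "\<dots> = 2 * degree (pderiv C)"
    unfolding YZ using nz assms by (simp add: degree_power_eq)
  finally have "degree Y + degree Z = 2 * degree (pderiv C)" .
  moreover have "degree X \<le> max (degree Y) (degree Z)"
  proof -
    have "smult (k + k) X = Y + Z"
      unfolding smult_add_left by (simp add: Y_def Z_def)
    then have "degree X = degree (Y + Z)"
      using \<open>k \<noteq> 0\<close> degree_smult_eq[of "k + k" X] by simp
    then show ?thesis
      using degree_add_le_max[of Y Z] by simp
  qed
  (* The factors have total degree twice that of C', yet one of them has the degree of X = V C'. *)
  ultimately show False
    using degX deg' by linarith
qed

section \<open>The plane spanned by a complex pivot\<close>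

locale pivot_plane =
  fixes \<phi> :: "real^'n::finite \<Rightarrow> real" and \<xi> \<eta> :: "real^'n" and a :: real
  assumes poly: "real_polynomial_function \<phi>"
    and mixed: "dir_deriv \<xi> (dir_deriv \<eta> \<phi>) = (\<lambda>x. 0)"
    and diagonal: "dir_deriv \<xi> (dir_deriv \<xi> \<phi>) = (\<lambda>x. dir_deriv \<eta> (dir_deriv \<eta> \<phi>) x + a)"
begin

abbreviation D where "D \<equiv> dir_deriv"

definition c where "c = D \<eta> (D \<eta> \<phi>)"

lemmas pf [intro, simp] = poly real_polynomial_function_dir_deriv

lemma pf_c [intro, simp]: "real_polynomial_function c"
  by (simp add: c_def)

lemma D_\<xi>_c [simp]: "D \<xi> c = (\<lambda>x. 0)"
  unfolding c_def by (simp only: dir_deriv_commute[of "D \<eta> \<phi>" \<xi> \<eta>] pf mixed dir_deriv_const)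

lemma D_D_\<xi>_\<xi>: "D v (D \<xi> (D \<xi> \<phi>)) = D v c"
  unfolding diagonal c_def by (subst dir_deriv_add) auto

text \<open>\<open>D\<^sub>\<eta> c\<close> agrees with \<open>D\<^sub>\<eta> D\<^sub>\<xi> D\<^sub>\<xi> \<phi>\<close>, in which the vanishing mixed derivative can be isolated.\<close>
lemma D_\<eta>_c [simp]: "D \<eta> c = (\<lambda>x. 0)"
proof -
  have "D \<eta> c = D \<xi> (D \<xi> (D \<eta> \<phi>))"
    unfolding D_D_\<xi>_\<xi>[symmetric] by (rule dir_deriv_commute_past[OF poly])
  then show ?thesis by (simp add: mixed)
qed

lemma D_D_c_eq_0 [simp]:
  "D \<xi> (D v c) = (\<lambda>x. 0)" "D \<eta> (D v c) = (\<lambda>x. 0)"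
  "D \<xi> (D u (D v c)) = (\<lambda>x. 0)" "D \<eta> (D u (D v c)) = (\<lambda>x. 0)"
  by (simp_all add: dir_deriv_commute[OF pf_c, of \<xi>] dir_deriv_commute[OF pf_c, of \<eta>]
      dir_deriv_commute_past[OF pf_c, of \<xi>] dir_deriv_commute_past[OF pf_c, of \<eta>])

lemma c_on_plane: "c (P + x *\<^sub>R \<xi> + y *\<^sub>R \<eta>) = c P"
  using quadratic_on_plane[of c \<xi> "\<lambda>x. 0" \<eta> P x y] by simp

lemma hessian_\<xi>_on_plane:
  "D v (D \<xi> \<phi>) (P + x *\<^sub>R \<xi> + y *\<^sub>R \<eta>) = x * D v c P + D v (D \<xi> \<phi>) P"
proof -
  have 1: "D \<xi> (D v (D \<xi> \<phi>)) = D v c"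
    unfolding D_D_\<xi>_\<xi>[symmetric] by (rule dir_deriv_commute) simp
  have 2: "D \<eta> (D v (D \<xi> \<phi>)) = (\<lambda>x. 0)"
    by (simp only: dir_deriv_commute[of "D \<xi> \<phi>" \<eta> v] dir_deriv_commute[of \<phi> \<eta> \<xi>] pf mixed dir_deriv_const)
  show ?thesis
    using quadratic_on_plane[of "D v (D \<xi> \<phi>)" \<xi> "\<lambda>x. 0" \<eta> P x y] by (simp add: 1 2)
qed

lemma hessian_\<eta>_on_plane:
  "D v (D \<eta> \<phi>) (P + x *\<^sub>R \<xi> + y *\<^sub>R \<eta>) = y * D v c P + D v (D \<eta> \<phi>) P"
proof -
  have 1: "D \<xi> (D v (D \<eta> \<phi>)) = (\<lambda>x. 0)"
    by (simp only: dir_deriv_commute[of "D \<eta> \<phi>" \<xi> v] pf mixed dir_deriv_const)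
  have 2: "D \<eta> (D v (D \<eta> \<phi>)) = D v c"
    unfolding c_def by (rule dir_deriv_commute) simp
  show ?thesis
    using quadratic_on_plane[of "D v (D \<eta> \<phi>)" \<xi> "\<lambda>x. 0" \<eta> P x y] by (simp add: 1 2)
qed

lemma hessian_on_plane:
  "D u (D v \<phi>) (P + x *\<^sub>R \<xi> + y *\<^sub>R \<eta>)
   = (x\<^sup>2 + y\<^sup>2) * (D u (D v c) P / 2) + x * D u (D v (D \<xi> \<phi>)) P + y * D u (D v (D \<eta> \<phi>)) P + D u (D v \<phi>) P"
proof -
  have 1: "D \<xi> (D u (D v \<phi>)) = D u (D v (D \<xi> \<phi>))" and 2: "D \<eta> (D u (D v \<phi>)) = D u (D v (D \<eta> \<phi>))"
    by (rule dir_deriv_commute_past[OF poly])+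
  have 11: "D \<xi> (D u (D v (D \<xi> \<phi>))) = D u (D v c)"
    unfolding D_D_\<xi>_\<xi>[symmetric] by (rule dir_deriv_commute_past) simp
  have 12: "D \<xi> (D u (D v (D \<eta> \<phi>))) = (\<lambda>x. 0)"
    by (simp only: dir_deriv_commute_past[of "D \<eta> \<phi>" \<xi>] pf mixed dir_deriv_const)
  have 22: "D \<eta> (D u (D v (D \<eta> \<phi>))) = D u (D v c)"
    unfolding c_def by (rule dir_deriv_commute_past) simp
  show ?thesis
    using quadratic_on_plane[of "D u (D v \<phi>)" \<xi> "D u (D v c)" \<eta> P x y] by (simp add: 1 2 11 12 22)
qed

text \<open>
  The hypothesis at a single point \<open>P\<close> would be one equation; used on the whole plane through \<open>P\<close> it becomes an
  identity between polynomials in \<open>x, y\<close> whose coefficients are attached to \<open>P\<close>.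
\<close>
lemma block_det_on_plane:
  assumes det: "\<And>P. block_det (c P + a) (c P) (D z (D \<xi> \<phi>) P) (D w (D \<xi> \<phi>) P)
      (D z (D \<eta> \<phi>) P) (D w (D \<eta> \<phi>) P) (D z (D z \<phi>) P) (D z (D w \<phi>) P) (D w (D w \<phi>) P) = \<delta>"
  shows "block_det (c P + a) (c P)
      (x * D z c P + D z (D \<xi> \<phi>) P) (x * D w c P + D w (D \<xi> \<phi>) P)
      (y * D z c P + D z (D \<eta> \<phi>) P) (y * D w c P + D w (D \<eta> \<phi>) P)
      ((x\<^sup>2 + y\<^sup>2) * (D z (D z c) P / 2) + x * D z (D z (D \<xi> \<phi>)) P + y * D z (D z (D \<eta> \<phi>)) P + D z (D z \<phi>) P)
      ((x\<^sup>2 + y\<^sup>2) * (D z (D w c) P / 2) + x * D z (D w (D \<xi> \<phi>)) P + y * D z (D w (D \<eta> \<phi>)) P + D z (D w \<phi>) P)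
      ((x\<^sup>2 + y\<^sup>2) * (D w (D w c) P / 2) + x * D w (D w (D \<xi> \<phi>)) P + y * D w (D w (D \<eta> \<phi>)) P + D w (D w \<phi>) P) = \<delta>"
  using det[of "P + x *\<^sub>R \<xi> + y *\<^sub>R \<eta>"]
  unfolding c_on_plane hessian_\<xi>_on_plane hessian_\<eta>_on_plane
    hessian_on_plane[of z z] hessian_on_plane[of z w] hessian_on_plane[of w w] .

text \<open>
  Both cases are decided on the line through \<open>P\<close> of direction \<open>z\<close>, where \<open>c\<close> restricts to a univariate polynomial \<open>C\<close>
  and \<open>D\<^sub>z c\<close> to its derivative.
\<close>
lemma dir_deriv_c_eq_0:
  assumes det: "\<And>P. block_det (c P + a) (c P) (D z (D \<xi> \<phi>) P) (D w (D \<xi> \<phi>) P)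
      (D z (D \<eta> \<phi>) P) (D w (D \<eta> \<phi>) P) (D z (D z \<phi>) P) (D z (D w \<phi>) P) (D w (D w \<phi>) P) = \<delta>"
    and "\<delta> \<noteq> 0"
  shows "D z c P = 0"
proof -
  note E = block_det_on_plane[OF det]
  obtain C where C: "\<And>s. c (P + s *\<^sub>R z) = poly C s"
    and C1: "\<And>s. D z c (P + s *\<^sub>R z) = poly (pderiv C) s"
    using polynomial_on_line[OF pf_c, of P z] by metis
  obtain C' where C': "\<And>s. D z c (P + s *\<^sub>R z) = poly C' s"
    and C2': "\<And>s. D z (D z c) (P + s *\<^sub>R z) = poly (pderiv C') s"
    using polynomial_on_line[of "D z c" P z] by (metis pf_c pf(2))
  have "C' = pderiv C"
    using C1 C' by (metis ext poly_eq_poly_eq_iff)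
  then have C2: "\<And>s. D z (D z c) (P + s *\<^sub>R z) = poly (pderiv (pderiv C)) s"
    using C2' by simp
  have "pderiv C = 0"
  proof (cases "a = 0")
    case True
    define Z where "Z x y Q = block_quot (c Q)
      (x * D z c Q + D z (D \<xi> \<phi>) Q) (x * D w c Q + D w (D \<xi> \<phi>) Q)
      (y * D z c Q + D z (D \<eta> \<phi>) Q) (y * D w c Q + D w (D \<eta> \<phi>) Q)
      ((x\<^sup>2 + y\<^sup>2) * (D z (D z c) Q / 2) + x * D z (D z (D \<xi> \<phi>)) Q + y * D z (D z (D \<eta> \<phi>)) Q + D z (D z \<phi>) Q)
      ((x\<^sup>2 + y\<^sup>2) * (D z (D w c) Q / 2) + x * D z (D w (D \<xi> \<phi>)) Q + y * D z (D w (D \<eta> \<phi>)) Q + D z (D w \<phi>) Q)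
      ((x\<^sup>2 + y\<^sup>2) * (D w (D w c) Q / 2) + x * D w (D w (D \<xi> \<phi>)) Q + y * D w (D w (D \<eta> \<phi>)) Q + D w (D w \<phi>) Q)" for x y Q
    have pf_Z: "real_polynomial_function (Z x y)" for x y
      unfolding Z_def block_quot_def
      by (intro real_polynomial_function.intros(2-4) real_polynomial_function_diff
          real_polynomial_function_divide real_polynomial_function_power pf pf_c)
    (* the quotient of \<delta> D z c by c *)
    define m where "m Q = Z 0 0 Q * D z c Q - ((Z 1 0 Q - Z (-1) 0 Q) * D z (D \<xi> \<phi>) Q
         + (Z 0 1 Q - Z 0 (-1) Q) * D z (D \<eta> \<phi>) Q) / 4" for Q
    have "real_polynomial_function m"
      unfolding m_def
      by (intro real_polynomial_function.intros(2-4) real_polynomial_function_diff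
          real_polynomial_function_divide pf_Z pf pf_c)
    then obtain M where M: "\<And>s. m (P + s *\<^sub>R z) = poly M s"
      using polynomial_on_line[of m P z] by metis
    have "\<delta> * D z c Q = c Q * m Q" for Q
      unfolding m_def
      by (rule block_det_const_imp_dvd[where Z = "\<lambda>x y. Z x y Q", OF _ E[unfolded True add_0_right]]) (simp only: Z_def)
    then have "poly (smult \<delta> (pderiv C)) s = poly (C * M) s" for s
      by (metis C C1 M poly_smult poly_mult)
    then have "smult \<delta> (pderiv C) = C * M"
      by (metis ext poly_eq_poly_eq_iff)
    then have "C dvd pderiv C"
      using \<open>\<delta> \<noteq> 0\<close> by (metis dvd_smult_cancel dvd_triv_left)
    then show ?thesis
      by (simp add: pderiv_eq_0_iff)
  next
    case False
    define t where "t Q = (c Q + a) * c Q * (D z c Q * D z (D w \<phi>) Q - D w c Q * D z (D z \<phi>) Q)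
        - c Q * D z (D \<xi> \<phi>) Q * (D z c Q * D w (D \<xi> \<phi>) Q - D w c Q * D z (D \<xi> \<phi>) Q)
        - (c Q + a) * D z (D \<eta> \<phi>) Q * (D z c Q * D w (D \<eta> \<phi>) Q - D w c Q * D z (D \<eta> \<phi>) Q)" for Q
    have "real_polynomial_function t"
      unfolding t_def
      by (intro real_polynomial_function.intros(2-4) real_polynomial_function_diff
          pf pf_c)
    then obtain T where T: "\<And>s. t (P + s *\<^sub>R z) = poly T s"
      using polynomial_on_line[of t P z] by metis
    have t: "(t Q)\<^sup>2 = - \<delta> * (c Q + a) * c Q * (D z c Q)\<^sup>2"
      if "c Q + a \<noteq> 0" "c Q \<noteq> 0" "D z c Q \<noteq> 0"
        "(c Q + a) * (D z (D z c) Q / 2) \<noteq> (D z c Q)\<^sup>2" "c Q * (D z (D z c) Q / 2) \<noteq> (D z c Q)\<^sup>2" for Q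
      unfolding t_def by (rule block_det_const_imp_square[OF refl E that(1-3) _ that(4,5)]) (use False in auto)
    show ?thesis
    proof (rule ccontr)
      assume nz: "pderiv C \<noteq> 0"
      define G where "G = C + [:a:]"
      have G': "pderiv G = pderiv C"
        by (simp add: G_def pderiv_add)
      (* The nondegeneracy conditions of the pointwise lemma are nonzero polynomials on the line,
         so its conclusion extends to the whole line. *)
      define L1 where "L1 = G * pderiv (pderiv C) - smult 2 ((pderiv C)\<^sup>2)"
      define L2 where "L2 = C * pderiv (pderiv C) - smult 2 ((pderiv C)\<^sup>2)"
      have L1: "L1 \<noteq> 0"
        using pderiv_eq_0_if_inverse_affine[of G] nz by (auto simp: L1_def G')
      have L2: "L2 \<noteq> 0"
        using pderiv_eq_0_if_inverse_affine[of C] nz by (auto simp: L2_def)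
      have "G \<noteq> 0" "C \<noteq> 0"
        using nz G' by auto
      define R where "R = T\<^sup>2 - smult (- \<delta>) (C * G * (pderiv C)\<^sup>2)"
      have "poly (C * G * pderiv C * L1 * L2 * R) s = 0" for s
      proof (cases "poly (C * G * pderiv C * L1 * L2) s = 0")
        case False
        then have "poly C s \<noteq> 0" "poly (pderiv C) s \<noteq> 0"
          "poly G s \<noteq> 0" "poly L1 s \<noteq> 0" "poly L2 s \<noteq> 0"
          by auto
        then have "(poly T s)\<^sup>2
            = - \<delta> * (poly C s + a) * poly C s * (poly (pderiv C) s)\<^sup>2"
          by (intro t[of "P + s *\<^sub>R z", unfolded C C1 C2 T]) (auto simp: G_def L1_def L2_def add.commute)
        then have "poly R s = 0"
          by (simp add: R_def G_def mult_ac add.commute)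
        then show ?thesis by simp
      qed simp
      then have "C * G * pderiv C * L1 * L2 * R = 0"
        by (intro poly_all_0_iff_0[THEN iffD1] allI)
      then have "R = 0"
        using L1 L2 nz \<open>G \<noteq> 0\<close> \<open>C \<noteq> 0\<close> by simp
      then show False
        using pderiv_eq_0_if_square_eq[of T "- \<delta>" C a] nz False \<open>\<delta> \<noteq> 0\<close> by (simp add: R_def G_def)
    qed
  qed
  then show ?thesis
    using C1[of 0] by simp
qed

end

section \<open>Existence of a real pivot\<close>

lemma obtain_frame_4:
  fixes \<xi> \<eta> z :: "real^4"
  assumes "\<eta> \<noteq> 0" "\<xi> \<notin> span {\<eta>}" "z \<notin> span {\<xi>, \<eta>}"
  obtains R :: "real^4^4" where "R $ 1 = \<xi>" "R $ 2 = \<eta>" "R $ 3 = z" "det R \<noteq> 0"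
proof -
  have "span {z, \<xi>, \<eta>} \<noteq> UNIV"
  proof
    assume "span {z, \<xi>, \<eta>} = UNIV"
    then have "dim (UNIV :: (real^4) set) \<le> card {z, \<xi>, \<eta>}"
      by (intro dim_le_card) auto
    also have "\<dots> \<le> 3"
      by (auto simp: card_insert_if)
    finally show False
      by simp
  qed
  then obtain w where w: "w \<notin> span {z, \<xi>, \<eta>}"
    by blast
  define R :: "real^4^4" where "R = (\<chi> i. if i = 1 then \<xi> else if i = 2 then \<eta> else if i = 3 then z else w)"
  have R: "R $ 1 = \<xi>" "R $ 2 = \<eta>" "R $ 3 = z" "R $ 4 = w"
    by (simp_all add: R_def)
  have "k i = 0" if k: "(\<Sum>i\<in>UNIV. k i *s row i R) = 0" for k i
  proof -
    have row: "row i R = R $ i" for i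
      by (simp add: row_def vec_eq_iff)
    have sum: "k 1 *\<^sub>R \<xi> + k 2 *\<^sub>R \<eta> + k 3 *\<^sub>R z + k 4 *\<^sub>R w = 0"
      using k unfolding sum_4 row R by (simp add: scalar_mult_eq_scaleR)
    have solve: "y \<in> span S" if "m *\<^sub>R y + v = 0" "m \<noteq> 0" "v \<in> span S" for m y v and S :: "(real^4) set"
    proof -
      have "y = (- 1 / m) *\<^sub>R v"
      proof -
        have "(1 / m) *\<^sub>R (m *\<^sub>R y + v) = 0"
          using that by simp
        then show ?thesis
          using \<open>m \<noteq> 0\<close> by (simp add: scaleR_add_right eq_neg_iff_add_eq_0)
      qed
      then show ?thesis
        using that(3) span_scale by metis
    qed
    have 4: "k 4 = 0"
    proof (rule ccontr)
      assume "k 4 \<noteq> 0"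
      moreover have "k 4 *\<^sub>R w + (k 1 *\<^sub>R \<xi> + k 2 *\<^sub>R \<eta> + k 3 *\<^sub>R z) = 0"
        using sum by (simp add: algebra_simps)
      moreover have "k 1 *\<^sub>R \<xi> + k 2 *\<^sub>R \<eta> + k 3 *\<^sub>R z \<in> span {z, \<xi>, \<eta>}"
        by (intro span_add span_scale span_base) auto
      ultimately show False
        using w solve by blast
    qed
    have 3: "k 3 = 0"
    proof (rule ccontr)
      assume "k 3 \<noteq> 0"
      moreover have "k 3 *\<^sub>R z + (k 1 *\<^sub>R \<xi> + k 2 *\<^sub>R \<eta>) = 0"
        using sum 4 by (simp add: algebra_simps)
      moreover have "k 1 *\<^sub>R \<xi> + k 2 *\<^sub>R \<eta> \<in> span {\<xi>, \<eta>}"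
        by (intro span_add span_scale span_base) auto
      ultimately show False
        using assms solve by blast
    qed
    have 1: "k 1 = 0"
    proof (rule ccontr)
      assume "k 1 \<noteq> 0"
      moreover have "k 1 *\<^sub>R \<xi> + k 2 *\<^sub>R \<eta> = 0"
        using sum 3 4 by simp
      moreover have "k 2 *\<^sub>R \<eta> \<in> span {\<eta>}"
        by (intro span_scale span_base) auto
      ultimately show False
        using assms solve by blast
    qed
    have "k 2 = 0"
      using sum 1 3 4 assms by simp
    with 1 3 4 show "k i = 0"
      using exhaust_4[of i] by auto
  qed
  then have "det R \<noteq> 0"
    unfolding invertible_det_nz[symmetric] invertible_right_inverse matrix_right_invertible_independent_rows
    by blast
  with R show ?thesis
    using that by blast
qed

theorem proposition4p9:
  fixes \<phi> :: "real^4 \<Rightarrow> real"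
  assumes "unimodular_hessian_potential 1 \<phi>"
    and "\<exists>\<zeta>. complex_constant_pivot \<phi> \<zeta>"
  shows "\<exists>\<xi>. real_constant_pivot \<phi> \<xi>"
proof -
  have \<phi>: "real_polynomial_function \<phi>"
    and det: "(\<forall>x. det (hess \<phi> x) = 1) \<or> (\<forall>x. det (hess \<phi> x) = -1)"
    using assms(1) by (simp_all add: unimodular_hessian_potential_def)
  obtain \<delta> where \<delta>: "\<And>x. det (hess \<phi> x) = \<delta>" "\<delta> \<noteq> 0"
    using det that[of 1] that[of "- 1"] by auto
  from assms(2) obtain \<zeta> where "complex_constant_pivot \<phi> \<zeta>" ..
  with \<phi> obtain \<xi> \<eta> a where nz: "\<xi> \<noteq> 0 \<or> \<eta> \<noteq> 0"
    and mixed: "dir_deriv \<xi> (dir_deriv \<eta> \<phi>) = (\<lambda>x. 0)"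
    and diagonal: "dir_deriv \<xi> (dir_deriv \<xi> \<phi>) = (\<lambda>x. dir_deriv \<eta> (dir_deriv \<eta> \<phi>) x + a)"
    by (rule complex_pivot_split)
  have pivotI: "real_constant_pivot \<phi> v" if "v \<noteq> 0" "\<And>x. dir_deriv v (dir_deriv v \<phi>) x = k" for v k
    using that unfolding real_constant_pivot_def hess_quadratic_form[OF \<phi>] by (auto simp: constant_on_def)
  interpret pivot_plane \<phi> \<xi> \<eta> a
    using \<phi> mixed diagonal by unfold_locales
  consider "\<eta> = 0" | "\<eta> \<noteq> 0" "\<xi> \<in> span {\<eta>}" | "\<eta> \<noteq> 0" "\<xi> \<notin> span {\<eta>}"
    by blast
  then show ?thesis
  proof cases
    case 1
    have "dir_deriv \<xi> (dir_deriv \<xi> \<phi>) x = a" for x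
      by (simp add: diagonal 1 dir_deriv_zero_direction)
    then show ?thesis
      using pivotI nz 1 by blast
  next
    case 2
    then obtain t where t: "\<xi> = t *\<^sub>R \<eta>"
      by (auto simp: span_singleton)
    have "t * dir_deriv \<eta> (dir_deriv \<eta> \<phi>) x = 0" for x
      using fun_cong[OF mixed, of x] by (simp add: t dir_deriv_scale_direction)
    moreover have "dir_deriv \<eta> (dir_deriv \<eta> \<phi>) x = - a" if "t = 0" for x
      using fun_cong[OF diagonal, of x] that by (simp add: t dir_deriv_zero_direction)
    ultimately have "dir_deriv \<eta> (dir_deriv \<eta> \<phi>) x = (if t = 0 then - a else 0)" for x
      by auto
    then show ?thesis
      using pivotI 2 by blast
  next
    case 3
    have off_plane: "dir_deriv z c = (\<lambda>x. 0)" if z: "z \<notin> span {\<xi>, \<eta>}" for z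
    proof
      fix P
      obtain R :: "real^4^4" where R: "R $ 1 = \<xi>" "R $ 2 = \<eta>" "R $ 3 = z" and "det R \<noteq> 0"
        by (rule obtain_frame_4[OF 3 z])
      have "block_det (c Q + a) (c Q) (D z (D \<xi> \<phi>) Q) (D (R $ 4) (D \<xi> \<phi>) Q)
          (D z (D \<eta> \<phi>) Q) (D (R $ 4) (D \<eta> \<phi>) Q) (D z (D z \<phi>) Q) (D z (D (R $ 4) \<phi>) Q)
          (D (R $ 4) (D (R $ 4) \<phi>) Q) = (det R)\<^sup>2 * \<delta>" for Q
      proof -
        have "(det R)\<^sup>2 * \<delta> = det (R ** hess \<phi> Q ** transpose R)"
          by (simp add: det_mul \<delta> power2_eq_square)
        also have "\<dots> = block_det (c Q + a) (c Q) (D z (D \<xi> \<phi>) Q) (D (R $ 4) (D \<xi> \<phi>) Q)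
            (D z (D \<eta> \<phi>) Q) (D (R $ 4) (D \<eta> \<phi>) Q) (D z (D z \<phi>) Q) (D z (D (R $ 4) \<phi>) Q)
            (D (R $ 4) (D (R $ 4) \<phi>) Q)"
          by (rule det_eq_block_det; simp only: hess_congruence[OF \<phi>] R c_def diagonal mixed
              dir_deriv_commute[OF \<phi>, of \<eta> \<xi>]
              dir_deriv_commute[OF \<phi>, of \<xi> z] dir_deriv_commute[OF \<phi>, of \<xi> "R $ 4"]
              dir_deriv_commute[OF \<phi>, of \<eta> z] dir_deriv_commute[OF \<phi>, of \<eta> "R $ 4"]
              dir_deriv_commute[OF \<phi>, of "R $ 4" z])
        finally show ?thesis ..
      qed
      then show "dir_deriv z c P = 0"
        by (rule dir_deriv_c_eq_0) (use \<open>det R \<noteq> 0\<close> \<delta>(2) in simp)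
    qed
    have "subspace {v. dir_deriv v c = (\<lambda>x. 0)}"
      unfolding subspace_def
      by (auto simp: dir_deriv_add_direction dir_deriv_scale_direction dir_deriv_zero_direction)
    then have "span {\<xi>, \<eta>} \<subseteq> {v. dir_deriv v c = (\<lambda>x. 0)}"
      by (rule span_minimal[rotated]) simp
    with off_plane have "dir_deriv v c = (\<lambda>x. 0)" for v
      by blast
    then have "c x = c 0" for x
      by (rule real_polynomial_function_const_if_dir_derivs_0[OF pf_c])
    then have "dir_deriv \<eta> (dir_deriv \<eta> \<phi>) x = c 0" for x
      by (simp add: c_def)
    then show ?thesis
      using pivotI 3 by blast
  qed
qed

end
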